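(* Consider the problem of maximizing a non-negative (not necessarily monotone) submodular function $f:2^{\mathcal{N}}\to\mathbb{R}_{\ge0}$ over a $k$-system $(\mathcal{N},\mathcal{I})$ with $|\mathcal{N}|=n$ and rank $r$, i.e. $\max\{f(S):S\in\mathcal{I}\}$, with access to a value oracle for $f$ and an independence oracle for $\mathcal{I}$. For every $\epsilon>0$ there exist: (1) a randomized algorithm with approximation ratio $(1+\epsilon)(1+\sqrt{k})^2$ (i.e., its output $S\in\mathcal{I}$ satisfies $\max\{f(X):X\in\mathcal{I}\}\le(1+\epsilon)(1+\sqrt k)^2\,\mathbb{E}[f(S)]$) using $\mathcal{O}(\frac{n}{\epsilon}\log\frac{r}{\epsilon})$ oracle queries; and (2) a deterministic algorithm with approximation ratio $(1+\epsilon)(k+\sqrt{k}+\lceil\sqrt{k}\rceil+1)$ using $\mathcal{O}(\frac{\sqrt{k}\,n}{\epsilon}\log\frac{\sqrt{k}\,r}{\epsilon})$ oracle queries.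
   Context: An independence system $(\mathcal{N},\mathcal{I})$ is a down-closed family $\mathcal{I}\subseteq 2^{\mathcal{N}}$ with $\emptyset\in\mathcal{I}$; for $X\subseteq Y$, $X$ is a base of $Y$ if $X\in\mathcal{I}$ and $X\cup\{u\}\notin\mathcal{I}$ for all $u\in Y\setminus X$; it is a $k$-system ($k\ge1$) if any two bases $X_1,X_2$ of any $Y\subseteq\mathcal{N}$ satisfy $|X_1|\le k|X_2|$. The rank is $r=\max\{|X|:X\in\mathcal{I}\}$. Time complexity is measured by the number of value oracle queries (returning $f(S)$) and independence oracle queries (returning whether $S\in\mathcal{I}$). *)

theory Defs
  imports "HOL-Probability.Probability"
begin

definition indep_system :: "'a set \<Rightarrow> 'a set set \<Rightarrow> bool" where
  "indep_system N I \<longleftrightarrow>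
     I \<subseteq> Pow N \<and> {} \<in> I \<and> (\<forall>X Y. X \<subseteq> Y \<and> Y \<in> I \<longrightarrow> X \<in> I)"

definition base_of :: "'a set set \<Rightarrow> 'a set \<Rightarrow> 'a set \<Rightarrow> bool" where
  "base_of I Y X \<longleftrightarrow> X \<subseteq> Y \<and> X \<in> I \<and> (\<forall>u\<in>Y - X. X \<union> {u} \<notin> I)"

definition k_system :: "real \<Rightarrow> 'a set \<Rightarrow> 'a set set \<Rightarrow> bool" where
  "k_system k N I \<longleftrightarrow> k \<ge> 1 \<and> indep_system N I \<and>
     (\<forall>Y X\<^sub>1 X\<^sub>2. Y \<subseteq> N \<and> base_of I Y X\<^sub>1 \<and> base_of I Y X\<^sub>2
        \<longrightarrow> real (card X\<^sub>1) \<le> k * real (card X\<^sub>2))"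

definition sys_rank :: "'a set set \<Rightarrow> nat" where
  "sys_rank I = Max (card ` I)"

definition submodular_on :: "'a set \<Rightarrow> ('a set \<Rightarrow> real) \<Rightarrow> bool" where
  "submodular_on N f \<longleftrightarrow>
     (\<forall>X Y. X \<subseteq> N \<and> Y \<subseteq> N \<longrightarrow> f (X \<union> Y) + f (X \<inter> Y) \<le> f X + f Y)"

definition opt :: "('a set \<Rightarrow> real) \<Rightarrow> 'a set set \<Rightarrow> real" where
  "opt f I = Max (f ` I)"

text \<open>
  Oracle algorithms as adaptive decision trees: the only access to the objective and to the
  constraint is through the two query nodes, whose continuations receive the oracle's answer.
  \<open>Toss p\<close> supplies a fresh Bernoulli bit of bias \<open>p\<close> and is not counted as a query.
\<close>

datatype ('a, 'x) oracle_alg =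
    Return 'x
  | Ask_Value "'a set" "real \<Rightarrow> ('a, 'x) oracle_alg"
  | Ask_Indep "'a set" "bool \<Rightarrow> ('a, 'x) oracle_alg"
  | Toss real "bool \<Rightarrow> ('a, 'x) oracle_alg"

primrec deterministic :: "('a, 'x) oracle_alg \<Rightarrow> bool" where
  "deterministic (Return x) \<longleftrightarrow> True"
| "deterministic (Ask_Value S c) \<longleftrightarrow> (\<forall>v. deterministic (c v))"
| "deterministic (Ask_Indep S c) \<longleftrightarrow> (\<forall>b. deterministic (c b))"
| "deterministic (Toss p c) \<longleftrightarrow> False"

text \<open>Joint distribution of the output and the number of oracle queries made.\<close>

primrec run ::
  "('a set \<Rightarrow> real) \<Rightarrow> 'a set set \<Rightarrow> ('a, 'x) oracle_alg \<Rightarrow> ('x \<times> nat) pmf" where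
  "run f I (Return x) = return_pmf (x, 0)"
| "run f I (Ask_Value S c) = map_pmf (apsnd Suc) (run f I (c (f S)))"
| "run f I (Ask_Indep S c) = map_pmf (apsnd Suc) (run f I (c (S \<in> I)))"
| "run f I (Toss p c) = bind_pmf (bernoulli_pmf p) (\<lambda>b. run f I (c b))"

lemma finite_set_pmf_run: "finite (set_pmf (run f I A))"
  by (induction A) (auto simp: set_bind_pmf)

lemma deterministic_run:
  "deterministic A \<Longrightarrow> \<exists>x q. run f I A = return_pmf (x, q)"
proof (induction A)
  case (Ask_Value S c)
  then obtain x q where "run f I (c (f S)) = return_pmf (x, q)" by fastforce
  then show ?case by (simp add: map_return_pmf)
next
  case (Ask_Indep S c)
  then obtain x q where "run f I (c (S \<in> I)) = return_pmf (x, q)" by fastforce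
  then show ?case by (simp add: map_return_pmf)
qed simp_all

end

theory Submission imports Defs begin

text \<open>
  The algorithm grows \<open>l\<close> disjoint solutions \<open>S\<^sub>i\<close> with geometrically decreasing thresholds: an element
  that fits into some \<open>S\<^sub>i\<close> with marginal gain at least the current threshold \<open>\<tau>\<close> is added to it with
  probability \<open>p\<close> and otherwise thrown away.

  Let \<open>Z\<close> be optimal. An element of \<open>Z\<close> outside \<open>S\<^sub>i\<close> was blocked by \<open>S\<^sub>i\<close>, or was offered to some
  solution while still fitting into \<open>S\<^sub>i\<close>, or has negligible gain in the end. The k-system property
  bounds the number of blocked elements plus \<open>|Z \<inter> S\<^sub>i|\<close> by \<open>k |S\<^sub>i|\<close> at any time, so with \<open>A\<close> and \<open>R\<close> the sums
  of the thresholds of accepted and rejected elements, and up to a factor \<open>1 + \<epsilon>\<close>,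
  \<open>\<Sum>\<^sub>i f(Z \<union> S\<^sub>i) - f(S\<^sub>i) \<le> (k + l - 2) A + l R\<close>, where \<open>A \<le> \<Sum>\<^sub>i f(S\<^sub>i)\<close> and
  \<open>E R = (1 - p)/p E A\<close>. On the other hand \<open>\<Sum>\<^sub>i f(Z \<union> S\<^sub>i) \<ge> (l - 1) f(Z) + f(Z \<union> \<Union>\<^sub>i S\<^sub>i)\<close> by
  disjointness, and \<open>E f(Z \<union> \<Union>\<^sub>i S\<^sub>i) \<ge> (1 - p) f(Z)\<close>. The choices \<open>l = 2\<close>, \<open>p = 2/(1 + \<surd>k)\<close> and
  \<open>l = \<lceil>\<surd>k\<rceil> + 1\<close>, \<open>p = 1\<close> give the two ratios.

  The rank is not known to the algorithm. The size of any base of the ground set determines it up to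
  a factor \<open>k\<close>, and this suffices for the last threshold because the approximation ratio exceeds \<open>k\<close>.
\<close>

section \<open>Composing oracle algorithms\<close>

primrec bind_alg ::
  "('a, 'x) oracle_alg \<Rightarrow> ('x \<Rightarrow> ('a, 'y) oracle_alg) \<Rightarrow> ('a, 'y) oracle_alg" where
  "bind_alg (Return x) g = g x"
| "bind_alg (Ask_Value S c) g = Ask_Value S (\<lambda>v. bind_alg (c v) g)"
| "bind_alg (Ask_Indep S c) g = Ask_Indep S (\<lambda>b. bind_alg (c b) g)"
| "bind_alg (Toss p c) g = Toss p (\<lambda>b. bind_alg (c b) g)"

primrec foldM_alg ::
  "('b \<Rightarrow> 's \<Rightarrow> ('a, 's) oracle_alg) \<Rightarrow> 'b list \<Rightarrow> 's \<Rightarrow> ('a, 's) oracle_alg" where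
  "foldM_alg h [] s = Return s"
| "foldM_alg h (x # xs) s = bind_alg (h x s) (foldM_alg h xs)"

primrec sat ::
  "('a set \<Rightarrow> real) \<Rightarrow> 'a set set \<Rightarrow> ('a, 'x) oracle_alg \<Rightarrow> ('x \<Rightarrow> nat \<Rightarrow> bool) \<Rightarrow> bool" where
  "sat f I (Return x) P = P x 0"
| "sat f I (Ask_Value S c) P = sat f I (c (f S)) (\<lambda>x q. P x (Suc q))"
| "sat f I (Ask_Indep S c) P = sat f I (c (S \<in> I)) (\<lambda>x q. P x (Suc q))"
| "sat f I (Toss p c) P = (\<forall>b. sat f I (c b) P)"

primrec ev ::
  "('a set \<Rightarrow> real) \<Rightarrow> 'a set set \<Rightarrow> ('x \<Rightarrow> real) \<Rightarrow> ('a, 'x) oracle_alg \<Rightarrow> real" where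
  "ev f I g (Return x) = g x"
| "ev f I g (Ask_Value S c) = ev f I g (c (f S))"
| "ev f I g (Ask_Indep S c) = ev f I g (c (S \<in> I))"
| "ev f I g (Toss p c) = measure_pmf.expectation (bernoulli_pmf p) (\<lambda>b. ev f I g (c b))"

lemma sat_set_pmf: "sat f I A P \<Longrightarrow> (x, q) \<in> set_pmf (run f I A) \<Longrightarrow> P x q"
proof (induction A arbitrary: P q)
  case (Ask_Value S c)
  then obtain q' where "(x, q') \<in> set_pmf (run f I (c (f S)))" "q = Suc q'" by auto
  with Ask_Value show ?case by fastforce
next
  case (Ask_Indep S c)
  then obtain q' where "(x, q') \<in> set_pmf (run f I (c (S \<in> I)))" "q = Suc q'" by auto
  with Ask_Indep show ?case by fastforce
next
  case (Toss p c)
  then show ?case by fastforce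
qed auto

lemma expectation_run: "measure_pmf.expectation (run f I A) (\<lambda>(x, q). g x) = ev f I g A"
proof (induction A)
  case (Toss p c)
  have "measure_pmf.expectation (run f I (Toss p c)) (\<lambda>(x, q). g x) =
     (\<Sum>b\<in>UNIV. pmf (bernoulli_pmf p) b *\<^sub>R
        measure_pmf.expectation (run f I (c b)) (\<lambda>(x, q). g x))"
    by (simp, subst pmf_expectation_bind[where A = UNIV]) (auto simp: finite_set_pmf_run)
  also have "\<dots> = ev f I g (Toss p c)"
    by (simp add: Toss integral_measure_pmf_real[where A = UNIV] mult.commute)
  finally show ?case .
qed (simp_all add: case_prod_unfold)

lemma sat_bind:
  "sat f I (bind_alg A g) P = sat f I A (\<lambda>x q. sat f I (g x) (\<lambda>y q'. P y (q + q')))"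
  by (induction A arbitrary: P) simp_all

lemma ev_bind: "ev f I g (bind_alg A h) = ev f I (\<lambda>x. ev f I g (h x)) A"
  by (induction A) simp_all

lemma sat_mono: "sat f I A P \<Longrightarrow> (\<And>x q. P x q \<Longrightarrow> Q x q) \<Longrightarrow> sat f I A Q"
proof (induction A arbitrary: P Q)
  case (Ask_Value S c)
  show ?case using Ask_Value.prems
    by (auto intro: Ask_Value.IH[of _ "\<lambda>x q. P x (Suc q)"])
next
  case (Ask_Indep S c)
  show ?case using Ask_Indep.prems
    by (auto intro: Ask_Indep.IH[of _ "\<lambda>x q. P x (Suc q)"])
next
  case (Toss p c)
  then show ?case by (metis rangeI sat.simps(4))
qed auto

lemma sat_conj: "sat f I A P \<Longrightarrow> sat f I A Q \<Longrightarrow> sat f I A (\<lambda>x q. P x q \<and> Q x q)"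
  by (induction A arbitrary: P Q) auto

lemma ev_mono: "sat f I A (\<lambda>x q. g x \<le> h x) \<Longrightarrow> ev f I g A \<le> ev f I h A"
proof (induction A)
  case (Toss p c)
  then show ?case
    by (auto intro!: integral_mono integrable_measure_pmf_finite)
qed auto

lemma ev_mult: "ev f I (\<lambda>x. a * g x) A = a * ev f I g A"
  by (induction A) simp_all

lemma ev_const: "ev f I (\<lambda>x. a) A = a"
  by (induction A) simp_all

lemma ev_bind_ge: "sat f I A (\<lambda>x q. a \<le> ev f I g (h x)) \<Longrightarrow> a \<le> ev f I g (bind_alg A h)"
  using ev_mono[of f I A "\<lambda>_. a"] by (simp add: ev_bind ev_const)

lemma sat_foldM:
  assumes "\<And>ys x zs s. xs = ys @ x # zs \<Longrightarrow> J ys s \<Longrightarrow>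
             sat f I (h x s) (\<lambda>s' q. J (ys @ [x]) s' \<and> q \<le> b)"
    and "J [] s"
  shows "sat f I (foldM_alg h xs s) (\<lambda>s' q. J xs s' \<and> q \<le> b * length xs)"
proof -
  have "xs = ys @ zs \<Longrightarrow> J ys s \<Longrightarrow>
     sat f I (foldM_alg h zs s) (\<lambda>s' q. J xs s' \<and> q \<le> b * length zs)" for ys zs s
  proof (induction zs arbitrary: ys s)
    case (Cons x zs)
    have "sat f I (h x s) (\<lambda>s' q. J (ys @ [x]) s' \<and> q \<le> b)"
      using assms(1) Cons.prems by blast
    then show ?case
      unfolding foldM_alg.simps sat_bind
    proof (rule sat_mono)
      fix s' q assume *: "J (ys @ [x]) s' \<and> q \<le> b"
      have "sat f I (foldM_alg h zs s') (\<lambda>s'' q. J xs s'' \<and> q \<le> b * length zs)"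
        by (rule Cons.IH[of "ys @ [x]"]) (use * Cons.prems in auto)
      then show "sat f I (foldM_alg h zs s') (\<lambda>y q'. J xs y \<and> q + q' \<le> b * length (x # zs))"
        by (rule sat_mono) (use * in auto)
    qed
  qed simp
  from this[of "[]" xs s] show ?thesis using assms(2) by simp
qed

lemma ev_foldM:
  assumes "\<And>x s. x \<in> set xs \<Longrightarrow> J s \<Longrightarrow> sat f I (h x s) (\<lambda>s' q. J s')"
    and "\<And>x s. x \<in> set xs \<Longrightarrow> J s \<Longrightarrow> \<Phi> s \<le> ev f I \<Phi> (h x s)"
    and "J s"
  shows "\<Phi> s \<le> ev f I \<Phi> (foldM_alg h xs s)"
  using assms
proof (induction xs arbitrary: s)
  case (Cons x xs)
  have "\<Phi> s \<le> ev f I \<Phi> (h x s)" using Cons.prems by simp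
  also have "\<dots> \<le> ev f I (\<lambda>s. ev f I \<Phi> (foldM_alg h xs s)) (h x s)"
  proof (rule ev_mono)
    show "sat f I (h x s) (\<lambda>s q. \<Phi> s \<le> ev f I \<Phi> (foldM_alg h xs s))"
      by (rule sat_mono[where P = "\<lambda>s q. J s"]) (use Cons in auto)
  qed
  finally show ?case by (simp add: ev_bind)
qed simp

lemma deterministic_bind:
  "deterministic A \<Longrightarrow> (\<And>x. deterministic (g x)) \<Longrightarrow> deterministic (bind_alg A g)"
  by (induction A) auto

lemma deterministic_foldM:
  "(\<And>x s. deterministic (h x s)) \<Longrightarrow> deterministic (foldM_alg h xs s)"
  by (induction xs arbitrary: s) (auto intro: deterministic_bind)

definition coin :: "real \<Rightarrow> (bool \<Rightarrow> ('a, 'x) oracle_alg) \<Rightarrow> ('a, 'x) oracle_alg" where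
  "coin p c = (if p = 1 then c True else Toss p c)"

lemma ev_coin:
  "0 \<le> p \<Longrightarrow> p \<le> 1 \<Longrightarrow> ev f I g (coin p c) = p * ev f I g (c True) + (1 - p) * ev f I g (c False)"
  by (auto simp: coin_def mult.commute)

lemma sat_coin: "(\<And>b. sat f I (c b) P) \<Longrightarrow> sat f I (coin p c) P"
  by (auto simp: coin_def)

section \<open>The threshold multi-greedy algorithm\<close>

text \<open>
  The state of the main loop is the log of all probes that passed the threshold, latest first: an
  entry \<open>(u, i, \<tau>, b)\<close> says that \<open>u\<close> was offered to the \<open>i\<close>-th solution at threshold \<open>\<tau>\<close> and that
  the coin accepted (\<open>b\<close>) or discarded it for good (\<open>\<not> b\<close>).
\<close>

type_synonym 'a log = "('a \<times> nat \<times> real \<times> bool) list"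

fun sol :: "nat \<Rightarrow> 'a log \<Rightarrow> 'a set" where
  "sol i [] = {}"
| "sol i ((u, j, \<tau>, b) # L) = (if b \<and> j = i then insert u (sol i L) else sol i L)"

definition seen :: "'a log \<Rightarrow> 'a set" where
  "seen L = fst ` set L"

lemma seen_simps [simp]: "seen [] = {}" "seen (e # L) = insert (fst e) (seen L)"
  by (auto simp: seen_def)

lemma sol_subset_seen: "sol i L \<subseteq> seen L"
  by (induction i L rule: sol.induct) auto

lemma finite_seen [simp]: "finite (seen L)"
  by (simp add: seen_def)

lemma finite_sol [simp]: "finite (sol i L)"
  by (rule finite_subset[OF sol_subset_seen finite_seen])

definition base_step :: "'a \<Rightarrow> 'a set \<Rightarrow> ('a, 'a set) oracle_alg" where
  "base_step u B = Ask_Indep (insert u B) (\<lambda>b. Return (if b then insert u B else B))"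

definition pick_step :: "'a set \<Rightarrow> 'a set \<times> real \<Rightarrow> ('a, 'a set \<times> real) oracle_alg" where
  "pick_step X s = Ask_Indep X (\<lambda>b. if b
     then Ask_Value X (\<lambda>y. Return (if y > snd s then (X, y) else s)) else Return s)"

definition pick :: "'a set list \<Rightarrow> ('a, 'a set \<times> real) oracle_alg" where
  "pick Xs = Ask_Value {} (\<lambda>v. foldM_alg pick_step Xs ({}, v))"

definition probe :: "real \<Rightarrow> real \<Rightarrow> 'a \<times> nat \<Rightarrow> 'a log \<Rightarrow> ('a, 'a log) oracle_alg" where
  "probe p \<tau> = (\<lambda>(u, i) L. if u \<in> seen L then Return L else
     Ask_Indep (insert u (sol i L)) (\<lambda>b. if b
       then Ask_Value (insert u (sol i L)) (\<lambda>y. Ask_Value (sol i L) (\<lambda>z.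
              if y - z \<ge> \<tau> then coin p (\<lambda>a. Return ((u, i, \<tau>, a) # L)) else Return L))
       else Return L))"

definition greedy :: "real \<Rightarrow> ('a \<times> nat) list \<Rightarrow> real list \<Rightarrow> ('a, 'a log) oracle_alg" where
  "greedy p us \<tau>s = foldM_alg (\<lambda>\<tau>. foldM_alg (probe p \<tau>) us) \<tau>s []"

definition passes :: "real \<Rightarrow> real \<Rightarrow> nat \<Rightarrow> nat" where
  "passes c d r = nat \<lceil>log c (real r / d)\<rceil>"

definition thresholds :: "real \<Rightarrow> real \<Rightarrow> nat \<Rightarrow> real list" where
  "thresholds c v m = map (\<lambda>j. v / c ^ j) [0..<Suc m]"

definition multi_greedy :: "real \<Rightarrow> nat \<Rightarrow> real \<Rightarrow> real \<Rightarrow> 'a list \<Rightarrow> ('a, 'a set) oracle_alg" where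
  "multi_greedy p l c d xs = (if xs = [] then Return {} else
     bind_alg (foldM_alg base_step xs {}) (\<lambda>B.
     bind_alg (pick (map (\<lambda>u. {u}) xs)) (\<lambda>(X, v).
     bind_alg (greedy p (List.product xs [0..<l]) (thresholds c v (passes c d (card B)))) (\<lambda>L.
     bind_alg (pick (X # map (\<lambda>i. sol i L) [0..<l])) (\<lambda>(Y, w). Return Y)))))"

lemma deterministic_multi_greedy: "deterministic (multi_greedy 1 l c d xs)"
  by (auto simp: multi_greedy_def greedy_def pick_def base_step_def pick_step_def probe_def coin_def
      intro!: deterministic_bind deterministic_foldM split: prod.splits)

section \<open>Analysis along a single run\<close>

lemma extend_to_base:
  assumes "finite Y" "D \<subseteq> Y" "D \<in> I"
  obtains X where "D \<subseteq> X" "base_of I Y X"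
proof -
  define F where "F = {X. D \<subseteq> X \<and> X \<subseteq> Y \<and> X \<in> I}"
  have "F \<subseteq> Pow Y" by (auto simp: F_def)
  then have "finite F" using assms(1) by (meson finite_Pow_iff finite_subset)
  moreover have "F \<noteq> {}" using assms by (auto simp: F_def)
  ultimately obtain X where X: "X \<in> F" "\<And>X'. X' \<in> F \<Longrightarrow> X \<subseteq> X' \<Longrightarrow> X = X'"
    using finite_has_maximal[of F] by auto
  have "X \<union> {u} \<notin> I" if "u \<in> Y - X" for u
    using X(2)[of "X \<union> {u}"] X(1) that by (auto simp: F_def)
  then have "base_of I Y X" using X(1) by (auto simp: base_of_def F_def)
  then show thesis using that X(1) by (auto simp: F_def)
qed

fun acc :: "nat \<Rightarrow> 'a log \<Rightarrow> real" where
  "acc i [] = 0"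
| "acc i ((u, j, \<tau>, b) # L) = acc i L + (if b \<and> j = i then \<tau> else 0)"

fun accs :: "'a log \<Rightarrow> real" where
  "accs [] = 0"
| "accs ((u, j, \<tau>, b) # L) = accs L + (if b then \<tau> else 0)"

fun rejs :: "'a log \<Rightarrow> real" where
  "rejs [] = 0"
| "rejs ((u, j, \<tau>, b) # L) = rejs L + (if b then 0 else \<tau>)"

fun excess :: "'a set \<Rightarrow> nat \<Rightarrow> 'a log \<Rightarrow> real" where
  "excess Z i [] = 0"
| "excess Z i ((u, j, \<tau>, b) # L) =
     excess Z i L + (if u \<in> Z then if b \<and> j = i then - \<tau> else \<tau> else 0)"

locale k_system_maximization =
  fixes N :: "'a set" and f :: "'a set \<Rightarrow> real" and I :: "'a set set" and k :: real
  assumes finite_N: "finite N"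
    and nonneg: "S \<subseteq> N \<Longrightarrow> 0 \<le> f S"
    and submod: "submodular_on N f"
    and ksys: "k_system k N I"
begin

abbreviation gain :: "'a \<Rightarrow> 'a set \<Rightarrow> real" where
  "gain v S \<equiv> f (insert v S) - f S"

lemma k_ge_1: "1 \<le> k" and empty_indep: "{} \<in> I"
  using ksys by (auto simp: k_system_def indep_system_def)

lemma indep_subset_N: "X \<in> I \<Longrightarrow> X \<subseteq> N"
  using ksys by (auto simp: k_system_def indep_system_def)

lemma indep_mono: "X \<subseteq> Y \<Longrightarrow> Y \<in> I \<Longrightarrow> X \<in> I"
  using ksys unfolding k_system_def indep_system_def by blast

lemma bases_card:
  "Y \<subseteq> N \<Longrightarrow> base_of I Y X \<Longrightarrow> base_of I Y X' \<Longrightarrow> real (card X) \<le> k * real (card X')"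
  using ksys unfolding k_system_def by blast

lemma submodD: "X \<subseteq> N \<Longrightarrow> Y \<subseteq> N \<Longrightarrow> f (X \<union> Y) + f (X \<inter> Y) \<le> f X + f Y"
  using submod by (simp add: submodular_on_def)

lemma gain_antimono:
  assumes "X \<subseteq> Y" "Y \<subseteq> N" "v \<in> N" "v \<notin> Y"
  shows "gain v Y \<le> gain v X"
proof -
  have "f (insert v X \<union> Y) + f (insert v X \<inter> Y) \<le> f (insert v X) + f Y"
    using assms by (intro submodD) auto
  moreover have "insert v X \<union> Y = insert v Y" "insert v X \<inter> Y = X" using assms by auto
  ultimately show ?thesis by simp
qed

lemma gain_sum:
  assumes "T \<subseteq> N" "S \<subseteq> N" "T \<inter> S = {}"
  shows "f (S \<union> T) - f S \<le> (\<Sum>v\<in>T. gain v S)"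
proof -
  have "finite T" using assms finite_N finite_subset by blast
  then show ?thesis using assms
  proof (induction T)
    case (insert v T)
    have "gain v (S \<union> T) \<le> gain v S" using insert by (intro gain_antimono) auto
    then show ?case using insert by auto
  qed simp
qed

lemma sum_union_disjoint_ge:
  assumes "Z \<subseteq> N" "\<And>i. i < l \<Longrightarrow> S i \<subseteq> N"
    and "\<And>i j. i < l \<Longrightarrow> j < l \<Longrightarrow> i \<noteq> j \<Longrightarrow> S i \<inter> S j = {}"
  shows "(real l - 1) * f Z + f (Z \<union> (\<Union>i<l. S i)) \<le> (\<Sum>i<l. f (Z \<union> S i))"
  using assms
proof (induction l)
  case (Suc l)
  let ?U = "\<Union>i<l. S i"
  have "S i \<inter> S l = {}" "S i \<subseteq> N" if "i < l" for i
    using Suc.prems(2,3)[of i] Suc.prems(3)[of i l] that by auto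
  then have U: "?U \<inter> S l = {}" "?U \<subseteq> N" by blast+
  have "Z \<subseteq> N" "S l \<subseteq> N" using Suc.prems(1,2) by auto
  have "f ((Z \<union> ?U) \<union> (Z \<union> S l)) + f ((Z \<union> ?U) \<inter> (Z \<union> S l)) \<le> f (Z \<union> ?U) + f (Z \<union> S l)"
    using U \<open>Z \<subseteq> N\<close> \<open>S l \<subseteq> N\<close> by (intro submodD) auto
  moreover have "(Z \<union> ?U) \<inter> (Z \<union> S l) = Z" using U by auto
  moreover have "(Z \<union> ?U) \<union> (Z \<union> S l) = Z \<union> (\<Union>i<Suc l. S i)" by (auto simp: less_Suc_eq)
  moreover have "(real l - 1) * f Z + f (Z \<union> ?U) \<le> (\<Sum>i<l. f (Z \<union> S i))"
    using Suc.prems by (intro Suc.IH) auto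
  ultimately show ?case by (simp add: algebra_simps)
qed simp

definition small :: "real \<Rightarrow> 'a log \<Rightarrow> 'a \<Rightarrow> nat \<Rightarrow> bool" where
  "small t L v j \<longleftrightarrow> v \<in> seen L \<or> insert v (sol j L) \<notin> I \<or> gain v (sol j L) \<le> t"

definition near :: "nat \<Rightarrow> 'a log \<Rightarrow> real \<Rightarrow> bool" where
  "near l L t \<longleftrightarrow> (\<forall>v\<in>N. \<forall>j<l. small t L v j)"

fun valid :: "nat \<Rightarrow> real \<Rightarrow> 'a log \<Rightarrow> bool" where
  "valid l c [] \<longleftrightarrow> True"
| "valid l c ((u, j, \<tau>, b) # L) \<longleftrightarrow> valid l c L \<and> u \<in> N - seen L \<and> j < l \<and>
     insert u (sol j L) \<in> I \<and> 0 \<le> \<tau> \<and> \<tau> \<le> gain u (sol j L) \<and> near l L (c * \<tau>) \<and>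
     (\<forall>(_, _, \<tau>', _) \<in> set L. \<tau> \<le> \<tau>')"

text \<open>
  The elements of \<open>Z\<close> that became infeasible for the \<open>i\<close>-th solution before being offered to any.
\<close>

fun blk :: "'a set \<Rightarrow> nat \<Rightarrow> 'a log \<Rightarrow> 'a set" where
  "blk Z i [] = {}"
| "blk Z i (e # L) = blk Z i L \<union> {v \<in> Z - seen (e # L). insert v (sol i (e # L)) \<notin> I}"

lemma valid_tau: "valid l c L \<Longrightarrow> \<forall>(_, _, \<tau>, _) \<in> set L. 0 \<le> \<tau>"
  by (induction l c L rule: valid.induct) auto

lemma valid_sol_indep: "valid l c L \<Longrightarrow> sol i L \<in> I"
  by (induction l c L rule: valid.induct) (auto simp: empty_indep)

lemma valid_sol_disjoint: "valid l c L \<Longrightarrow> i \<noteq> j \<Longrightarrow> sol i L \<inter> sol j L = {}"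
proof (induction l c L rule: valid.induct)
  case (2 l c u j' \<tau> b L)
  then have "u \<notin> sol i L" "u \<notin> sol j L"
    using sol_subset_seen[of i L] sol_subset_seen[of j L] by auto
  then show ?case using 2 by auto
qed simp

lemma sol_mono: "sol i L \<subseteq> sol i (e # L)"
  by (cases e) auto

lemma acc_le: "valid l c L \<Longrightarrow> f {} + acc i L \<le> f (sol i L)"
  by (induction l c L rule: valid.induct) auto

lemma sum_acc: "valid l c L \<Longrightarrow> (\<Sum>i<l. acc i L) = accs L"
  by (induction l c L rule: valid.induct) (auto simp: sum.distrib)

lemma sum_excess:
  "valid l c L \<Longrightarrow> 2 \<le> l \<Longrightarrow> (\<Sum>i<l. excess Z i L) \<le> (real l - 2) * accs L + real l * rejs L"
proof (induction l c L rule: valid.induct)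
  case (2 l c u j \<tau> b L)
  have "(\<Sum>i<l. if u \<in> Z then if b \<and> j = i then - \<tau> else \<tau> else 0) \<le>
     (if b then (real l - 2) * \<tau> else real l * \<tau>)"
  proof (cases "u \<in> Z \<and> b")
    case True
    have "(\<Sum>i<l. if j = i then - \<tau> else \<tau>) = (\<Sum>i<l. \<tau> + (if i = j then - 2 * \<tau> else 0))"
      by (intro sum.cong) auto
    also have "\<dots> = (real l - 2) * \<tau>" using 2 by (simp add: sum.distrib algebra_simps)
    finally show ?thesis using True by simp
  next
    case False
    have "(\<Sum>i<l. if u \<in> Z then if b \<and> j = i then - \<tau> else \<tau> else 0) =
      (\<Sum>i<l. if u \<in> Z then \<tau> else 0)"
      using False by (intro sum.cong) auto
    then show ?thesis using 2 False by auto
  qed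
  then show ?case using 2 by (auto simp: sum.distrib algebra_simps)
qed simp

lemma blk_props:
  assumes "valid l c L"
  shows "v \<in> blk Z i L \<Longrightarrow> v \<in> Z \<and> v \<notin> sol i L \<and> insert v (sol i L) \<notin> I"
  using assms
proof (induction L)
  case (Cons e L)
  have "valid l c L" using Cons.prems by (cases e) auto
  have 1: "v \<in> Z" "insert v (sol i (e # L)) \<notin> I"
    using Cons \<open>valid l c L\<close> sol_mono[of i L e]
      indep_mono[of "insert v (sol i L)" "insert v (sol i (e # L))"]
    by auto
  then show ?case using valid_sol_indep[OF Cons.prems(2), of i] by (metis insert_absorb)
qed simp

lemma blk_complete:
  assumes "Z \<in> I" "v \<in> Z - seen L" "insert v (sol i L) \<notin> I"
  shows "v \<in> blk Z i L"
proof (cases L)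
  case Nil
  then show ?thesis using assms indep_mono[of "{v}" Z] by auto
next
  case (Cons e L')
  then show ?thesis using assms by auto
qed

lemma blk_card:
  assumes "valid l c L" "Z \<in> I"
  shows "real (card (blk Z i L \<union> (Z \<inter> sol i L))) \<le> k * real (card (sol i L))"
proof -
  let ?S = "sol i L" and ?D = "blk Z i L \<union> (Z \<inter> sol i L)"
  have D: "?D \<subseteq> Z" using blk_props[OF assms(1)] by auto
  have N: "?S \<union> ?D \<subseteq> N"
    using D indep_subset_N[OF assms(2)] indep_subset_N[OF valid_sol_indep[OF assms(1), of i]] by blast
  have "finite (?S \<union> ?D)" by (rule finite_subset[OF N finite_N])
  moreover have "?D \<in> I" using indep_mono[OF D assms(2)] .
  ultimately obtain X where X: "?D \<subseteq> X" "base_of I (?S \<union> ?D) X"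
    using extend_to_base[of "?S \<union> ?D" ?D I] by blast
  have "base_of I (?S \<union> ?D) ?S"
    using blk_props[OF assms(1), of _ Z i] valid_sol_indep[OF assms(1), of i]
    by (auto simp: base_of_def)
  then have "real (card X) \<le> k * real (card ?S)" using bases_card[OF N X(2)] by blast
  moreover have "X \<subseteq> N" using X(2) N by (auto simp: base_of_def)
  then have "card ?D \<le> card X" using X(1) finite_N by (meson card_mono finite_subset)
  ultimately show ?thesis by linarith
qed

definition charged :: "'a set \<Rightarrow> nat \<Rightarrow> 'a log \<Rightarrow> 'a set" where
  "charged Z i L = blk Z i L \<union> (Z \<inter> seen L - sol i L)"

text \<open>
  Thresholds decrease along the run, so the counting bound \<open>blk_card\<close>, which holds at every moment,
  turns into a bound on threshold sums by Abel summation; the term with \<open>t\<close> is the slack that makes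
  the induction go through.
\<close>

lemma charged_gain:
  fixes t c :: real
  assumes "valid l c L" "Z \<in> I" "i < l" "0 \<le> c" "0 \<le> t" "\<forall>(_, _, \<tau>', _) \<in> set L. t \<le> \<tau>'"
  shows "(\<Sum>v\<in>charged Z i L. gain v (sol i L)) \<le>
     c * (k * acc i L - t * (k * card (sol i L) - card (blk Z i L \<union> (Z \<inter> sol i L))) + excess Z i L)"
  using assms
proof (induction L arbitrary: t)
  case (Cons e L)
  obtain u j \<tau> b where e: "e = (u, j, \<tau>, b)" by (cases e) auto
  let ?S = "sol i L" and ?S' = "sol i (e # L)"
  let ?B = "blk Z i L" and ?B' = "blk Z i (e # L)"
  let ?E = "charged Z i L" and ?E' = "charged Z i (e # L)"
  define D where "D = real (card (?B \<union> (Z \<inter> ?S)))"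
  define D' where "D' = real (card (?B' \<union> (Z \<inter> ?S')))"
  have v: "valid l c L" and u: "u \<in> N" "u \<notin> seen L" and \<tau>: "0 \<le> \<tau>"
    and near: "near l L (c * \<tau>)" and le: "\<forall>(_, _, \<tau>', _) \<in> set L. \<tau> \<le> \<tau>'" and t: "t \<le> \<tau>"
    and ins: "insert u (sol j L) \<in> I"
    using Cons.prems by (auto simp: e)
  have v': "valid l c (e # L)" by fact
  have ZN: "Z \<subseteq> N" using Cons.prems indep_subset_N by blast
  have S'N: "?S' \<subseteq> N" using valid_sol_indep[OF v'] indep_subset_N by blast
  have SS: "?S \<subseteq> ?S'" by (rule sol_mono)
  have BB: "?B \<subseteq> ?B'" by simp
  have B'Z: "?B' \<subseteq> Z" and B'S: "?B' \<inter> ?S' = {}" using blk_props[OF v'] by blast+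
  have BS: "?B \<inter> ?S = {}" using blk_props[OF v] by blast
  have fin: "finite Z" "finite ?B'" "finite ?B"
    using finite_subset[OF ZN finite_N] finite_subset[OF B'Z] finite_subset[OF BB] by auto
  have E'Z: "?E' \<subseteq> Z" using B'Z by (auto simp: charged_def)
  have E'S: "?E' \<inter> ?S' = {}" using B'S by (auto simp: charged_def)
  have uS: "u \<notin> ?S" using u sol_subset_seen[of i L] by auto
  have uB: "u \<notin> ?B" if "b" "j = i" using blk_props[OF v, of u Z i] ins that by auto
  have EE: "?E \<subseteq> ?E'" using uB BB uS u(2) by (auto simp: charged_def e)
  have finE: "finite ?E'" using finite_subset[OF E'Z fin(1)] .
  have new: "w \<in> (?B' - ?B) \<union> (if u \<in> Z \<and> \<not> (b \<and> j = i) then {u} else {})"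
    and new_gain: "gain w ?S \<le> c * \<tau>" if w: "w \<in> ?E' - ?E" for w
  proof -
    have unseen: "w \<notin> seen L"
      using w u by (auto simp: charged_def e split: if_splits)
    have wB: "w \<notin> ?B" using w by (auto simp: charged_def)
    show "w \<in> (?B' - ?B) \<union> (if u \<in> Z \<and> \<not> (b \<and> j = i) then {u} else {})"
      using w unseen wB by (auto simp: charged_def e split: if_splits)
    have "w \<in> Z" using w E'Z by blast
    then have "insert w ?S \<in> I" using blk_complete[of Z w L i] Cons.prems(2) unseen wB by blast
    then show "gain w ?S \<le> c * \<tau>"
      using near unseen \<open>w \<in> Z\<close> ZN \<open>i < l\<close> by (auto simp: near_def small_def)
  qed
  have anti: "gain w ?S' \<le> gain w ?S" if "w \<in> ?E'" for w
    using that E'Z ZN E'S SS S'N by (intro gain_antimono) auto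
  have "(\<Sum>w\<in>?E'. gain w ?S') \<le> (\<Sum>w\<in>?E'. gain w ?S)" by (intro sum_mono anti)
  also have "\<dots> = (\<Sum>w\<in>?E' - ?E. gain w ?S) + (\<Sum>w\<in>?E. gain w ?S)"
    by (rule sum.subset_diff[OF EE finE])
  also have "(\<Sum>w\<in>?E' - ?E. gain w ?S) \<le> real (card (?E' - ?E)) * (c * \<tau>)"
    by (intro sum_bounded_above new_gain)
  also have "(\<Sum>w\<in>?E. gain w ?S) \<le> c * (k * acc i L - \<tau> * (k * card ?S - D) + excess Z i L)"
    unfolding D_def by (rule Cons.IH) (use Cons.prems v \<tau> le in auto)
  finally have 1: "(\<Sum>w\<in>?E'. gain w ?S') \<le> real (card (?E' - ?E)) * (c * \<tau>) +
      c * (k * acc i L - \<tau> * (k * card ?S - D) + excess Z i L)" by simp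
  have "card (?E' - ?E) \<le> card ((?B' - ?B) \<union> (if u \<in> Z \<and> \<not> (b \<and> j = i) then {u} else {}))"
  proof (rule card_mono)
    show "?E' - ?E \<subseteq> (?B' - ?B) \<union> (if u \<in> Z \<and> \<not> (b \<and> j = i) then {u} else {})"
      using new by (rule subsetI)
  qed (use fin in auto)
  also have "\<dots> \<le> card (?B' - ?B) + (if u \<in> Z \<and> \<not> (b \<and> j = i) then 1 else 0)"
    by (rule order_trans[OF card_Un_le]) auto
  also have "card (?B' - ?B) = card ?B' - card ?B" by (rule card_Diff_subset[OF fin(3) BB])
  finally have 2: "real (card (?E' - ?E)) \<le>
      real (card ?B') - real (card ?B) + (if u \<in> Z \<and> \<not> (b \<and> j = i) then 1 else 0)"
    using card_mono[OF fin(2) BB] by (auto split: if_splits)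
  have 3: "D = real (card ?B) + real (card (Z \<inter> ?S))"
    using BS fin by (subst of_nat_add[symmetric], subst card_Un_disjoint[symmetric]) (auto simp: D_def)
  have 4: "D' = real (card ?B') + real (card (Z \<inter> ?S'))"
    using B'S fin by (subst of_nat_add[symmetric], subst card_Un_disjoint[symmetric]) (auto simp: D'_def)
  have 5: "real (card ?S') = real (card ?S) + (if b \<and> j = i then 1 else 0)"
    using uS by (auto simp: e)
  have 6: "real (card (Z \<inter> ?S')) = real (card (Z \<inter> ?S)) + (if u \<in> Z \<and> b \<and> j = i then 1 else 0)"
    using uS by (auto simp: e)
  have "real (card (?E' - ?E)) * (c * \<tau>) \<le>
      (real (card ?B') - real (card ?B) + (if u \<in> Z \<and> \<not> (b \<and> j = i) then 1 else 0)) * (c * \<tau>)"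
    using 2 \<tau> \<open>0 \<le> c\<close> by (intro mult_right_mono) auto
  with 1 have "(\<Sum>w\<in>?E'. gain w ?S') \<le>
      c * (k * acc i (e # L) - \<tau> * (k * card ?S' - D') + excess Z i (e # L))"
    unfolding 3 4 5 6 by (auto simp: e algebra_simps split: if_splits)
  also have "\<dots> \<le> c * (k * acc i (e # L) - t * (k * card ?S' - D') + excess Z i (e # L))"
    using blk_card[OF v' Cons.prems(2), of i] t \<open>0 \<le> c\<close> unfolding D'_def
    by (intro mult_left_mono add_right_mono diff_left_mono mult_right_mono) auto
  finally show ?case by (simp add: D'_def)
qed (simp add: charged_def)

lemma log_bound:
  fixes t c :: real
  assumes "valid l c L" "near l L t" "Z \<in> I" "2 \<le> l" "0 \<le> c" "0 \<le> t"
  shows "(real l - 1) * f Z + f (Z \<union> (\<Union>i<l. sol i L)) \<le>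
     (\<Sum>i<l. f (sol i L)) + c * ((k + real l - 2) * accs L + real l * rejs L) + real l * (card Z * t)"
proof -
  have ZN: "Z \<subseteq> N" and finZ: "finite Z"
    using assms indep_subset_N finite_N finite_subset by metis+
  have SN: "sol i L \<subseteq> N" for i using valid_sol_indep[OF assms(1)] indep_subset_N by blast
  have "f (Z \<union> sol i L) \<le> f (sol i L) + c * (k * acc i L + excess Z i L) + card Z * t"
    if "i < l" for i
  proof -
    let ?S = "sol i L" and ?E = "charged Z i L"
    have sub: "?E \<subseteq> Z - ?S" using blk_props[OF assms(1)] by (auto simp: charged_def)
    have "f (?S \<union> (Z - ?S)) - f ?S \<le> (\<Sum>v\<in>Z - ?S. gain v ?S)"
      using ZN SN by (intro gain_sum) auto
    also have "\<dots> = (\<Sum>v\<in>Z - ?S - ?E. gain v ?S) + (\<Sum>v\<in>?E. gain v ?S)"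
      using finZ by (intro sum.subset_diff[OF sub]) auto
    also have "(\<Sum>v\<in>?E. gain v ?S) \<le> c * (k * acc i L + excess Z i L)"
      using charged_gain[OF assms(1) assms(3) that assms(5), of 0] valid_tau[OF assms(1)] by simp
    also have "(\<Sum>v\<in>Z - ?S - ?E. gain v ?S) \<le> card (Z - ?S - ?E) * t"
    proof (rule sum_bounded_above)
      fix v assume v: "v \<in> Z - ?S - ?E"
      then have "v \<notin> seen L" "v \<notin> blk Z i L" by (auto simp: charged_def)
      then have "insert v ?S \<in> I" using blk_complete[OF assms(3), of v L i] v by blast
      then show "gain v ?S \<le> t"
        using assms(2) \<open>v \<notin> seen L\<close> v ZN that by (auto simp: near_def small_def)
    qed
    also have "card (Z - ?S - ?E) * t \<le> card Z * t"
      using finZ assms(6) by (intro mult_right_mono) (auto intro!: card_mono)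
    finally show ?thesis by (simp add: Un_commute)
  qed
  then have "(\<Sum>i<l. f (Z \<union> sol i L)) \<le>
      (\<Sum>i<l. f (sol i L) + c * (k * acc i L + excess Z i L) + card Z * t)"
    by (intro sum_mono) auto
  also have "\<dots> = (\<Sum>i<l. f (sol i L)) + c * (k * accs L + (\<Sum>i<l. excess Z i L)) + real l * (card Z * t)"
    unfolding sum_acc[OF assms(1), symmetric] by (simp add: sum.distrib sum_distrib_left algebra_simps)
  also have "\<dots> \<le> (\<Sum>i<l. f (sol i L)) + c * (k * accs L + ((real l - 2) * accs L + real l * rejs L))
      + real l * (card Z * t)"
    using sum_excess[OF assms(1,4), of Z] assms(5)
    by (intro add_right_mono add_left_mono mult_left_mono) auto
  also have "\<dots> = (\<Sum>i<l. f (sol i L)) + c * ((k + real l - 2) * accs L + real l * rejs L)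
      + real l * (card Z * t)"
    by (simp add: algebra_simps)
  finally show ?thesis
    using sum_union_disjoint_ge[OF ZN SN valid_sol_disjoint[OF assms(1)], of l "\<lambda>i. i"] by auto
qed

section \<open>The expected value\<close>

definition pot :: "real \<Rightarrow> 'a set \<Rightarrow> 'a set \<Rightarrow> 'a set \<Rightarrow> real" where
  "pot p Z R X = (1 - p) * f (Z \<union> X) + p * Min ((\<lambda>T. f (Z \<union> X \<union> T)) ` Pow R)"

lemma pot_le:
  assumes "finite R" "0 \<le> p"
  shows "pot p Z R X \<le> f (Z \<union> X)"
proof -
  have "Min ((\<lambda>T. f (Z \<union> X \<union> T)) ` Pow R) \<le> f (Z \<union> X)"
    using assms by (intro Min_le) (auto intro!: image_eqI[where x = "{}"])
  then have "p * Min ((\<lambda>T. f (Z \<union> X \<union> T)) ` Pow R) \<le> p * f (Z \<union> X)"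
    using assms by (intro mult_left_mono)
  then show ?thesis by (simp add: pot_def algebra_simps)
qed

lemma pot_ge:
  assumes "Z \<union> R \<subseteq> N" "0 \<le> p"
  shows "(1 - p) * f Z \<le> pot p Z R {}"
proof -
  have "finite R" using assms finite_N finite_subset by auto
  then have "0 \<le> Min ((\<lambda>T. f (Z \<union> {} \<union> T)) ` Pow R)"
    using assms nonneg by (subst Min_ge_iff) auto
  then show ?thesis using assms by (simp add: pot_def)
qed

text \<open>
  An element joins a random set with probability \<open>p\<close> only once, even if it is chosen adaptively;
  this is the potential form of the sampling lemma \<open>E f(Z \<union> X) \<ge> (1 - p) f(Z)\<close>.
\<close>

lemma pot_step:
  assumes "u \<in> R" "Z \<subseteq> N" "X \<subseteq> N" "R \<subseteq> N" "0 \<le> p" "p \<le> 1"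
  shows "pot p Z R X \<le> p * pot p Z (R - {u}) (insert u X) + (1 - p) * pot p Z (R - {u}) X"
proof -
  have fin: "finite R" "finite (R - {u})" using assms finite_N finite_subset by auto
  let ?m = "Min ((\<lambda>T. f (Z \<union> X \<union> T)) ` Pow R)"
  let ?m1 = "Min ((\<lambda>T. f (Z \<union> insert u X \<union> T)) ` Pow (R - {u}))"
  let ?m2 = "Min ((\<lambda>T. f (Z \<union> X \<union> T)) ` Pow (R - {u}))"
  have "?m1 \<in> (\<lambda>T. f (Z \<union> insert u X \<union> T)) ` Pow (R - {u})"
    using fin by (intro Min_in) auto
  then obtain T1 where T1: "T1 \<subseteq> R - {u}" "?m1 = f (Z \<union> insert u X \<union> T1)" by auto
  have "?m2 \<in> (\<lambda>T. f (Z \<union> X \<union> T)) ` Pow (R - {u})"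
    using fin by (intro Min_in) auto
  then obtain T2 where T2: "T2 \<subseteq> R - {u}" "?m2 = f (Z \<union> X \<union> T2)" by auto
  have m: "?m \<le> f (Z \<union> X \<union> insert u T)" if "T \<subseteq> R - {u}" for T
    using that fin assms(1) by (intro Min_le) (auto intro!: image_eqI[where x = "insert u T"])
  have eq: "Z \<union> insert u X \<union> T1 = Z \<union> X \<union> insert u T1" by auto
  have m1: "?m \<le> ?m1" using m[OF T1(1)] unfolding T1(2) eq .
  have "f ((Z \<union> insert u X) \<union> (Z \<union> X \<union> T2)) + f ((Z \<union> insert u X) \<inter> (Z \<union> X \<union> T2))
      \<le> f (Z \<union> insert u X) + f (Z \<union> X \<union> T2)"
    using T2(1) assms by (intro submodD) auto
  moreover have "(Z \<union> insert u X) \<union> (Z \<union> X \<union> T2) = Z \<union> X \<union> insert u T2"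
    "(Z \<union> insert u X) \<inter> (Z \<union> X \<union> T2) = Z \<union> X" using T2(1) by auto
  ultimately have "f (Z \<union> X) + ?m \<le> f (Z \<union> insert u X) + ?m2"
    using m[OF T2(1)] unfolding T2(2) by simp
  then have "(p * (1 - p)) * (f (Z \<union> X) + ?m) \<le> (p * (1 - p)) * (f (Z \<union> insert u X) + ?m2)"
    using assms by (intro mult_left_mono) auto
  moreover have "(p * p) * ?m \<le> (p * p) * ?m1"
    using m1 assms by (intro mult_left_mono) auto
  ultimately show ?thesis unfolding pot_def by (simp add: algebra_simps)
qed

definition potential :: "real \<Rightarrow> nat \<Rightarrow> real \<Rightarrow> 'a set \<Rightarrow> 'a log \<Rightarrow> real" where
  "potential p l c Z L = (real l - 1) * f Z + pot p Z (N - seen L) (\<Union>i<l. sol i L)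
     + c * real l / p * ((1 - p) * accs L - p * rejs L)"

lemma potential_coin:
  assumes "u \<in> N - seen L" "seen L \<subseteq> N" "j < l" "Z \<subseteq> N" "0 < p" "p \<le> 1"
  shows "potential p l c Z L \<le> p * potential p l c Z ((u, j, \<tau>, True) # L)
           + (1 - p) * potential p l c Z ((u, j, \<tau>, False) # L)"
proof -
  let ?X = "\<Union>i<l. sol i L"
  have T: "(\<Union>i<l. sol i ((u, j, \<tau>, True) # L)) = insert u ?X" using assms(3) by auto
  have F: "(\<Union>i<l. sol i ((u, j, \<tau>, False) # L)) = ?X" by auto
  have R: "N - seen ((u, j, \<tau>, b) # L) = N - seen L - {u}" for b by auto
  have "?X \<subseteq> N" using sol_subset_seen[of _ L] assms(2) by fast
  then have "pot p Z (N - seen L) ?X \<le> p * pot p Z (N - seen L - {u}) (insert u ?X)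
      + (1 - p) * pot p Z (N - seen L - {u}) ?X"
    using assms by (intro pot_step) auto
  moreover define w where "w = c * real l / p"
  ultimately show ?thesis
    unfolding potential_def T F R w_def[symmetric] by (simp add: algebra_simps)
qed

lemma ev_probe:
  assumes "seen L \<subseteq> N" "u \<in> N" "j < l" "Z \<subseteq> N" "0 < p" "p \<le> 1"
  shows "potential p l c Z L \<le> ev f I (potential p l c Z) (probe p \<tau> (u, j) L)"
  using potential_coin[of u L j l Z p c \<tau>] assms by (auto simp: probe_def ev_coin)

lemma sat_probe_seen:
  assumes "seen L \<subseteq> N" "u \<in> N"
  shows "sat f I (probe p \<tau> (u, j) L) (\<lambda>L' q. seen L' \<subseteq> N)"
  using assms by (auto simp: probe_def intro!: sat_coin)

lemma ev_greedy:
  assumes "set us \<subseteq> N \<times> {..<l}" "Z \<subseteq> N" "0 < p" "p \<le> 1"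
  shows "(real l - p) * f Z \<le> ev f I (potential p l c Z) (greedy p us \<tau>s)"
proof -
  have sat: "sat f I (foldM_alg (probe p \<tau>) us L) (\<lambda>L' q. seen L' \<subseteq> N)" if "seen L \<subseteq> N" for \<tau> L
  proof (rule sat_mono[OF sat_foldM[where J = "\<lambda>_ L. seen L \<subseteq> N"]])
    fix ys x zs L assume *: "us = ys @ x # zs" "seen L \<subseteq> N"
    obtain u j where x: "x = (u, j)" by fastforce
    then have "u \<in> N" using * assms(1) by auto
    have "sat f I (probe p \<tau> x L) (\<lambda>L' q. q \<le> 3)" by (auto simp: probe_def x intro!: sat_coin)
    from sat_conj[OF sat_probe_seen[OF *(2) \<open>u \<in> N\<close>] this[unfolded x]]
    show "sat f I (probe p \<tau> x L) (\<lambda>L' q. seen L' \<subseteq> N \<and> q \<le> 3)" by (simp add: x)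
  qed (use that in auto)
  have step: "potential p l c Z L \<le> ev f I (potential p l c Z) (foldM_alg (probe p \<tau>) us L)"
    if "seen L \<subseteq> N" for \<tau> L
  proof (rule ev_foldM[where J = "\<lambda>L. seen L \<subseteq> N"])
    fix x L assume *: "x \<in> set us" "seen L \<subseteq> N"
    obtain u j where x: "x = (u, j)" "u \<in> N" "j < l" using *(1) assms(1) by (cases x) auto
    show "sat f I (probe p \<tau> x L) (\<lambda>L' q. seen L' \<subseteq> N)"
      unfolding x(1) by (rule sat_probe_seen) fact+
    show "potential p l c Z L \<le> ev f I (potential p l c Z) (probe p \<tau> x L)"
      unfolding x(1) by (rule ev_probe) fact+
  qed fact
  have "(real l - p) * f Z \<le> potential p l c Z []"
    using pot_ge[of Z N p] assms by (simp add: potential_def algebra_simps)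
  also have "\<dots> \<le> ev f I (potential p l c Z) (greedy p us \<tau>s)"
    unfolding greedy_def by (rule ev_foldM[where J = "\<lambda>L. seen L \<subseteq> N"]) (auto intro: sat step)
  finally show ?thesis .
qed

lemma potential_le:
  fixes t c d p v y :: real
  assumes "valid l c L" "near l L t" "Z \<in> I" "2 \<le> l" "1 \<le> c" "0 \<le> t" "0 < p" "p \<le> 1" "0 \<le> d"
    and "card Z * t \<le> k * d * v" "v \<le> y" "\<And>i. i < l \<Longrightarrow> f (sol i L) \<le> y"
  shows "potential p l c Z L \<le>
     real l * (c * (k + real l - 1 + real l * (1 - p) / p) + k * d) * y"
proof -
  let ?F = "\<Sum>i<l. f (sol i L)" and ?\<rho> = "real l * (1 - p) / p"
  have "sol i L \<subseteq> N" for i using valid_sol_indep[OF assms(1)] indep_subset_N by blast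
  then have "0 \<le> f (sol 0 L)" by (rule nonneg)
  then have y: "0 \<le> y" using assms(4) assms(12)[of 0] by auto
  have F: "?F \<le> real l * y" using sum_mono[of "{..<l}" "\<lambda>i. f (sol i L)" "\<lambda>_. y"] assms(12) by simp
  have A: "accs L \<le> real l * y"
  proof -
    have "accs L \<le> ?F" unfolding sum_acc[OF assms(1), symmetric]
      using acc_le[OF assms(1)] nonneg[of "{}"] by (intro sum_mono) (smt (verit) empty_subsetI)
    then show ?thesis using F by simp
  qed
  have \<rho>: "0 \<le> ?\<rho>" using assms by auto
  have "card Z * t \<le> k * d * y"
    using k_ge_1 assms(9) by (intro order_trans[OF assms(10)] mult_left_mono assms(11)) auto
  then have loss: "real l * (card Z * t) \<le> real l * (k * d * y)" by (intro mult_left_mono) auto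
  have "pot p Z (N - seen L) (\<Union>i<l. sol i L) \<le> f (Z \<union> (\<Union>i<l. sol i L))"
    using finite_N assms(7) by (intro pot_le) auto
  then have "potential p l c Z L \<le> ?F + c * ((k + real l - 2) * accs L + real l * rejs L)
      + real l * (card Z * t) + c * real l / p * ((1 - p) * accs L - p * rejs L)"
    using log_bound[OF assms(1-4) _ assms(6)] assms(5) unfolding potential_def by auto
  also have "\<dots> = ?F + c * (k + real l - 2 + ?\<rho>) * accs L + real l * (card Z * t)"
    using assms(7) by (simp add: field_simps)
  also have "\<dots> \<le> real l * y + c * (k + real l - 2 + ?\<rho>) * (real l * y) + real l * (k * d * y)"
    using F A loss \<rho> k_ge_1 assms(4,5) by (intro add_mono mult_left_mono mult_nonneg_nonneg) auto
  also have "\<dots> \<le> c * (real l * y) + c * (k + real l - 2 + ?\<rho>) * (real l * y) + real l * (k * d * y)"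
    using y assms(5) mult_right_mono[of 1 c "real l * y"] by auto
  also have "\<dots> = real l * (c * (k + real l - 1 + ?\<rho>) + k * d) * y"
    by (simp add: algebra_simps)
  finally show ?thesis .
qed

section \<open>The guarantees of the algorithm\<close>

lemma sat_base:
  "sat f I (foldM_alg base_step xs {}) (\<lambda>B q. base_of I (set xs) B \<and> q \<le> length xs)"
proof -
  have "sat f I (foldM_alg base_step xs {}) (\<lambda>B q. base_of I (set xs) B \<and> q \<le> 1 * length xs)"
  proof (rule sat_foldM)
    fix ys x zs B assume "base_of I (set ys) B"
    then show "sat f I (base_step x B) (\<lambda>B' q. base_of I (set (ys @ [x])) B' \<and> q \<le> 1)"
      using indep_mono[of "insert _ B" "insert _ (insert x B)"]
      by (auto simp: base_step_def base_of_def insert_commute)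
  qed (simp add: base_of_def empty_indep)
  then show ?thesis by simp
qed

lemma sat_pick:
  "sat f I (pick Xs) (\<lambda>(X, v) q. X \<in> I \<and> v = f X \<and> (\<forall>Y\<in>set Xs. Y \<in> I \<longrightarrow> f Y \<le> v) \<and>
     q \<le> 2 * length Xs + 1)"
proof -
  let ?J = "\<lambda>Ys (X, v). X \<in> I \<and> v = f X \<and> (\<forall>Y\<in>set Ys. Y \<in> I \<longrightarrow> f Y \<le> v)"
  have "sat f I (foldM_alg pick_step Xs ({}, f {})) (\<lambda>s q. ?J Xs s \<and> q \<le> 2 * length Xs)"
    by (rule sat_foldM) (auto simp: pick_step_def empty_indep)
  then show ?thesis unfolding pick_def sat.simps by (rule sat_mono) auto
qed

lemma small_Cons:
  assumes "valid l c (e # L)" "v \<in> N" "small t L v j"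
  shows "small t (e # L) v j"
proof (cases "v \<in> seen (e # L) \<or> insert v (sol j (e # L)) \<notin> I")
  case False
  have sub: "sol j L \<subseteq> sol j (e # L)" by (rule sol_mono)
  then have "insert v (sol j L) \<in> I"
    using False indep_mono[of "insert v (sol j L)" "insert v (sol j (e # L))"] by auto
  then have "gain v (sol j L) \<le> t" using assms(3) False by (auto simp: small_def)
  moreover have "gain v (sol j (e # L)) \<le> gain v (sol j L)"
  proof (rule gain_antimono[OF sub])
    show "sol j (e # L) \<subseteq> N" using valid_sol_indep[OF assms(1)] indep_subset_N by blast
    show "v \<notin> sol j (e # L)" using False sol_subset_seen[of j "e # L"] by blast
  qed fact
  ultimately show ?thesis by (simp add: small_def)
qed (auto simp: small_def)

lemma near_Cons: "valid l c (e # L) \<Longrightarrow> near l L t \<Longrightarrow> near l (e # L) t"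
  by (auto simp: near_def intro: small_Cons)

definition pass_inv :: "nat \<Rightarrow> real \<Rightarrow> real \<Rightarrow> ('a \<times> nat) list \<Rightarrow> 'a log \<Rightarrow> bool" where
  "pass_inv l c \<tau> ys L \<longleftrightarrow> valid l c L \<and> near l L (c * \<tau>) \<and>
     (\<forall>(_, _, \<tau>', _) \<in> set L. \<tau> \<le> \<tau>') \<and> (\<forall>(v, j) \<in> set ys. v \<in> N \<and> small \<tau> L v j)"

lemma sat_probe:
  assumes inv: "pass_inv l c \<tau> ys L" and "u \<in> N" "i < l" "0 \<le> \<tau>"
  shows "sat f I (probe p \<tau> (u, i) L) (\<lambda>L' q. pass_inv l c \<tau> (ys @ [(u, i)]) L' \<and> q \<le> 3)"
proof -
  have same: "pass_inv l c \<tau> (ys @ [(u, i)]) L" if "small \<tau> L u i"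
    using inv that \<open>u \<in> N\<close> by (auto simp: pass_inv_def)
  have new: "pass_inv l c \<tau> (ys @ [(u, i)]) ((u, i, \<tau>, a) # L)"
    if "u \<notin> seen L" "insert u (sol i L) \<in> I" "\<tau> \<le> gain u (sol i L)" for a
  proof -
    have v: "valid l c ((u, i, \<tau>, a) # L)"
      using inv that assms(2-4) by (auto simp: pass_inv_def)
    have "near l ((u, i, \<tau>, a) # L) (c * \<tau>)"
      using near_Cons[OF v] inv by (auto simp: pass_inv_def)
    moreover have "v \<in> N \<and> small \<tau> ((u, i, \<tau>, a) # L) v j" if "(v, j) \<in> set ys" for v j
      using small_Cons[OF v] inv that by (auto simp: pass_inv_def)
    moreover have "small \<tau> ((u, i, \<tau>, a) # L) u i" by (simp add: small_def)
    ultimately show ?thesis using v inv \<open>u \<in> N\<close> by (auto simp: pass_inv_def)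
  qed
  show ?thesis
  proof (cases "u \<in> seen L \<or> insert u (sol i L) \<notin> I \<or> \<not> \<tau> \<le> gain u (sol i L)")
    case True
    then have "small \<tau> L u i" by (auto simp: small_def)
    from same[OF this] True show ?thesis by (auto simp: probe_def)
  next
    case False
    then show ?thesis using new by (auto simp: probe_def intro!: sat_coin)
  qed
qed

lemma sat_pass:
  assumes "set us = N \<times> {..<l}" "0 \<le> \<tau>"
    and "valid l c L" "near l L (c * \<tau>)" "\<forall>(_, _, \<tau>', _) \<in> set L. \<tau> \<le> \<tau>'"
  shows "sat f I (foldM_alg (probe p \<tau>) us L) (\<lambda>L' q. valid l c L' \<and> near l L' \<tau> \<and>
     (\<forall>(_, _, \<tau>', _) \<in> set L'. \<tau> \<le> \<tau>') \<and> q \<le> 3 * length us)"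
proof -
  have "sat f I (foldM_alg (probe p \<tau>) us L) (\<lambda>L' q. pass_inv l c \<tau> us L' \<and> q \<le> 3 * length us)"
  proof (rule sat_foldM)
    fix ys x zs L assume *: "us = ys @ x # zs" "pass_inv l c \<tau> ys L"
    have "x \<in> N \<times> {..<l}" using *(1) assms(1) by auto
    then show "sat f I (probe p \<tau> x L) (\<lambda>L' q. pass_inv l c \<tau> (ys @ [x]) L' \<and> q \<le> 3)"
      using sat_probe[OF *(2)] assms(2) by auto
  qed (use assms in \<open>auto simp: pass_inv_def\<close>)
  then show ?thesis
    by (rule sat_mono) (use assms(1) in \<open>auto simp: pass_inv_def near_def\<close>)
qed

lemma sat_greedy:
  assumes us: "set us = N \<times> {..<l}" and c: "1 < c" and "0 \<le> v"
    and v: "\<forall>u. {u} \<in> I \<longrightarrow> f {u} \<le> v"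
  shows "sat f I (greedy p us (thresholds c v m)) (\<lambda>L q. valid l c L \<and> near l L (v / c ^ m) \<and>
     q \<le> 3 * length us * Suc m)"
proof -
  let ?t = "\<lambda>ys. c * v / c ^ length ys"
  let ?J = "\<lambda>ys L. valid l c L \<and> near l L (?t ys) \<and> (\<forall>(_, _, \<tau>', _) \<in> set L. ?t ys \<le> \<tau>')"
  have "sat f I (greedy p us (thresholds c v m))
    (\<lambda>L q. ?J (thresholds c v m) L \<and> q \<le> 3 * length us * length (thresholds c v m))"
    unfolding greedy_def
  proof (rule sat_foldM)
    fix ys \<tau> zs L assume *: "thresholds c v m = ys @ \<tau> # zs" "?J ys L"
    have "length ys < length (thresholds c v m)" using *(1) by simp
    moreover have "\<tau> = thresholds c v m ! length ys" using *(1) by simp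
    ultimately have \<tau>: "\<tau> = v / c ^ length ys"
      by (simp add: thresholds_def nth_append del: upt_Suc)
    then have t: "?t ys = c * \<tau>" "?t (ys @ [\<tau>]) = \<tau>" using c by auto
    have "0 \<le> \<tau>" using \<tau> c \<open>0 \<le> v\<close> by simp
    then have "\<tau> \<le> c * \<tau>" using c mult_right_mono[of 1 c \<tau>] by simp
    then show "sat f I (foldM_alg (probe p \<tau>) us L) (\<lambda>L' q. ?J (ys @ [\<tau>]) L' \<and> q \<le> 3 * length us)"
      unfolding t using sat_pass[OF us \<open>0 \<le> \<tau>\<close>, of c L p] *(2)[unfolded t] by (fastforce elim!: sat_mono)
  next
    have "gain u {} \<le> c * v" if "{u} \<in> I" for u
    proof -
      have "gain u {} \<le> v" using v[rule_format, OF that] nonneg[of "{}"] by simp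
      also have "v \<le> c * v" using c \<open>0 \<le> v\<close> mult_right_mono[of 1 c v] by simp
      finally show ?thesis .
    qed
    then show "?J [] []" by (simp add: near_def small_def)
  qed
  then show ?thesis
    by (rule sat_mono) (use c in \<open>auto simp: thresholds_def\<close>)
qed

lemma passes_power:
  assumes "1 < c" "0 < d"
  shows "real r \<le> d * c ^ passes c d r"
proof (cases "r = 0")
  case False
  then have "log c (real r / d) \<le> real (passes c d r)"
    unfolding passes_def by (simp add: le_of_int_ceiling le_nat_iff real_nat_ceiling_ge)
  then have "real r / d \<le> c powr real (passes c d r)"
    using assms False by (simp add: log_le_iff)
  then show ?thesis using assms by (simp add: powr_realpow field_simps)
qed (use assms in auto)

lemma passes_mono:
  assumes "1 < c" "0 < d" "r \<le> r'"
  shows "passes c d r \<le> passes c d r'"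
proof (cases "r = 0")
  case False
  then have "log c (real r / d) \<le> log c (real r' / d)"
    using assms by (subst log_le_cancel_iff) (auto simp: divide_right_mono)
  then show ?thesis unfolding passes_def by (intro nat_mono ceiling_mono)
qed (simp add: passes_def log_def)

lemma finite_I: "finite I"
  using ksys finite_N finite_subset[of I "Pow N"] by (auto simp: k_system_def indep_system_def)

lemma card_le_rank: "X \<in> I \<Longrightarrow> card X \<le> sys_rank I"
  unfolding sys_rank_def using finite_I by (intro Max_ge) auto

lemma card_le_base:
  assumes "Z \<in> I" "base_of I N B"
  shows "real (card Z) \<le> k * real (card B)"
proof -
  obtain X where X: "Z \<subseteq> X" "base_of I N X"
    using extend_to_base[OF finite_N indep_subset_N[OF assms(1)] assms(1)] .
  then have "X \<subseteq> N" by (auto simp: base_of_def)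
  then have "card Z \<le> card X" using X(1) finite_N by (meson card_mono finite_subset)
  then show ?thesis using bases_card[OF subset_refl X(2) assms(2)] by linarith
qed

lemma sat_multi_greedy:
  assumes xs: "set xs = N" "distinct xs" and l: "2 \<le> l" and c: "1 < c" and d: "0 < d"
  shows "sat f I (multi_greedy p l c d xs)
     (\<lambda>S q. S \<in> I \<and> q \<le> 12 * (l * card N * Suc (passes c d (sys_rank I))))"
proof (cases "xs = []")
  case False
  let ?us = "List.product xs [0..<l]"
  define n where "n = card N"
  have n: "length xs = n" using xs distinct_card n_def by fastforce
  have n1: "1 \<le> n" using False n by (cases xs) auto
  define W where "W = l * n * Suc (passes c d (sys_rank I))"
  have W: "l * n * 1 \<le> W" unfolding W_def by (rule mult_le_mono2) simp
  have Wn: "1 * n \<le> l * n" "l * 1 \<le> l * n" using n1 l by (intro mult_le_mono; simp)+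
  have nW: "n \<le> W" "l \<le> W" using W Wn by linarith+
  have us: "set ?us = N \<times> {..<l}" using xs(1) by auto
  show ?thesis
    unfolding multi_greedy_def if_not_P[OF False] sat_bind[of f I "foldM_alg base_step xs {}"]
  proof (intro sat_mono[OF sat_base])
    fix B q1 assume B: "base_of I (set xs) B \<and> q1 \<le> length xs"
    have "card B \<le> sys_rank I" using B by (intro card_le_rank) (auto simp: base_of_def)
    then have "passes c d (card B) \<le> passes c d (sys_rank I)" by (rule passes_mono[OF c d])
    then have m: "l * n * Suc (passes c d (card B)) \<le> W"
      unfolding W_def by (intro mult_le_mono2) simp
    show "sat f I (bind_alg (pick (map (\<lambda>u. {u}) xs)) (\<lambda>(X, v).
       bind_alg (greedy p ?us (thresholds c v (passes c d (card B)))) (\<lambda>L.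
       bind_alg (pick (X # map (\<lambda>i. sol i L) [0..<l])) (\<lambda>(Y, w). Return Y))))
       (\<lambda>S q. S \<in> I \<and> q1 + q \<le> 12 * (l * card N * Suc (passes c d (sys_rank I))))"
      unfolding sat_bind
    proof (intro sat_mono[OF sat_pick], clarify)
      fix X q2 assume X: "X \<in> I" "\<forall>Y\<in>set (map (\<lambda>u. {u}) xs). Y \<in> I \<longrightarrow> f Y \<le> f X"
        "q2 \<le> 2 * length (map (\<lambda>u. {u}) xs) + 1"
      have "0 \<le> f X" using nonneg indep_subset_N[OF X(1)] by blast
      have v: "\<forall>u. {u} \<in> I \<longrightarrow> f {u} \<le> f X" using X(2) indep_subset_N xs(1) by force
      show "sat f I (bind_alg (greedy p ?us (thresholds c (f X) (passes c d (card B)))) (\<lambda>L.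
         bind_alg (pick (X # map (\<lambda>i. sol i L) [0..<l])) (\<lambda>(Y, w). Return Y)))
         (\<lambda>S q. S \<in> I \<and> q1 + (q2 + q) \<le> 12 * (l * card N * Suc (passes c d (sys_rank I))))"
        unfolding sat_bind
      proof (intro sat_mono[OF sat_greedy[OF us c \<open>0 \<le> f X\<close> v]] sat_mono[OF sat_pick], elim conjE, clarify)
        fix L q3 Y q4
        assume q3: "q3 \<le> 3 * length ?us * Suc (passes c d (card B))"
          and Y: "Y \<in> I" and q4: "q4 \<le> 2 * length (X # map (\<lambda>i. sol i L) [0..<l]) + 1"
        have "q3 \<le> 3 * W" using q3 m by (simp add: n algebra_simps)
        moreover have "q1 \<le> n" "q2 \<le> 2 * n + 1" "q4 \<le> 2 * l + 3" using B X(3) q4 n by auto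
        ultimately have "q1 + (q2 + (q3 + (q4 + 0))) \<le> 12 * W" using nW l by linarith
        then show "sat f I (Return Y) (\<lambda>S q. S \<in> I \<and> q1 + (q2 + (q3 + (q4 + q))) \<le>
            12 * (l * card N * Suc (passes c d (sys_rank I))))"
          using Y by (simp add: W_def n_def)
      qed
    qed
  qed
qed (auto simp: multi_greedy_def empty_indep)

lemma ev_multi_greedy:
  assumes xs: "set xs = N" and l: "2 \<le> l" and c: "1 < c" and d: "0 < d"
    and p: "0 < p" "p \<le> 1" and Z: "Z \<in> I"
  shows "(real l - p) * f Z \<le> real l * (c * (k + real l - 1 + real l * (1 - p) / p) + k * d)
     * ev f I f (multi_greedy p l c d xs)"
proof -
  define Q where "Q = real l * (c * (k + real l - 1 + real l * (1 - p) / p) + k * d)"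
  have "1 \<le> k + real l - 1 + real l * (1 - p) / p" using k_ge_1 l p by (simp add: add_increasing2)
  then have "1 * 1 \<le> c * (k + real l - 1 + real l * (1 - p) / p)" using c by (intro mult_mono) auto
  moreover have "0 \<le> k * d" using k_ge_1 d by simp
  ultimately have "real l * 1 \<le> Q" unfolding Q_def by (intro mult_left_mono) auto
  then have Q: "real l \<le> Q" "0 < Q" using l by auto
  have "(real l - p) * f Z \<le> Q * ev f I f (multi_greedy p l c d xs)"
  proof (cases "xs = []")
    case True
    then have "Z = {}" using xs indep_subset_N[OF Z] by auto
    then show ?thesis using True Q p nonneg[of "{}"]
      by (auto simp: multi_greedy_def intro!: mult_right_mono)
  next
    case False
    let ?us = "List.product xs [0..<l]"
    have us: "set ?us = N \<times> {..<l}" using xs by auto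
    let ?rest = "\<lambda>X L. bind_alg (pick (X # map (\<lambda>i. sol i L) [0..<l])) (\<lambda>(Y, w). Return Y)"
    have "(real l - p) * f Z / Q \<le> ev f I f (multi_greedy p l c d xs)"
      unfolding multi_greedy_def if_not_P[OF False]
    proof (rule ev_bind_ge, rule sat_mono[OF sat_base], rule ev_bind_ge,
        rule sat_mono[OF sat_pick], clarify)
      fix B q1 X q2
      assume B: "base_of I (set xs) B" and X: "X \<in> I"
        "\<forall>Y\<in>set (map (\<lambda>u. {u}) xs). Y \<in> I \<longrightarrow> f Y \<le> f X"
      let ?m = "passes c d (card B)"
      let ?G = "greedy p ?us (thresholds c (f X) ?m)"
      have fX: "0 \<le> f X" using nonneg indep_subset_N[OF X(1)] by blast
      have v: "\<forall>u. {u} \<in> I \<longrightarrow> f {u} \<le> f X" using X(2) indep_subset_N xs by force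
      have "real (card Z) \<le> k * real (card B)" using card_le_base[OF Z] B xs by simp
      also have "\<dots> \<le> k * (d * c ^ ?m)"
        using passes_power[OF c d, of "card B"] k_ge_1 by (intro mult_left_mono) auto
      finally have "real (card Z) * (f X / c ^ ?m) \<le> k * (d * c ^ ?m) * (f X / c ^ ?m)"
        using fX c by (intro mult_right_mono) auto
      then have loss: "real (card Z) * (f X / c ^ ?m) \<le> k * d * f X" using c by simp
      have "(real l - p) * f Z \<le> ev f I (potential p l c Z) ?G"
        using us indep_subset_N[OF Z] p by (intro ev_greedy) auto
      also have "\<dots> \<le> ev f I (\<lambda>L. Q * ev f I f (?rest X L)) ?G"
      proof (intro ev_mono sat_mono[OF sat_greedy[OF us c fX v]], elim conjE)
        fix L assume L: "valid l c L" "near l L (f X / c ^ ?m)"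
        have "potential p l c Z L / Q \<le> ev f I f (?rest X L)"
        proof (intro ev_bind_ge sat_mono[OF sat_pick], clarify)
          fix Y q
          assume Y: "\<forall>Y'\<in>set (X # map (\<lambda>i. sol i L) [0..<l]). Y' \<in> I \<longrightarrow> f Y' \<le> f Y"
          have "potential p l c Z L \<le> Q * f Y"
            unfolding Q_def
          proof (rule potential_le[OF L Z l _ _ p _ loss])
            show "f X \<le> f Y" using Y X(1) by simp
            show "f (sol i L) \<le> f Y" if "i < l" for i
              using Y valid_sol_indep[OF L(1)] that by simp
          qed (use c d fX in auto)
          then show "potential p l c Z L / Q \<le> ev f I f (Return Y)"
            using Q by (simp add: divide_le_eq mult.commute)
        qed
        then show "potential p l c Z L \<le> Q * ev f I f (?rest X L)"
          using Q by (simp add: divide_le_eq mult.commute)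
      qed
      also have "\<dots> = Q * ev f I f (bind_alg ?G (?rest X))" by (simp add: ev_mult ev_bind)
      finally show "(real l - p) * f Z / Q \<le> ev f I f (bind_alg ?G (?rest X))"
        using Q by (simp add: divide_le_eq mult.commute)
    qed
    then show ?thesis using Q by (simp add: divide_le_eq mult.commute)
  qed
  then show ?thesis unfolding Q_def .
qed

lemma opt_attained: obtains Z where "Z \<in> I" "opt f I = f Z"
proof -
  have "opt f I \<in> f ` I" unfolding opt_def using finite_I empty_indep by (intro Max_in) auto
  then show thesis using that by auto
qed

end

lemma passes_bound:
  assumes "0 < \<epsilon>"
  shows "real (Suc (passes (1 + min 1 \<epsilon> / 3) (\<epsilon> / 3) r)) \<le>
    16 / min 1 \<epsilon> * max 1 (ln (real r / \<epsilon>))"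
proof -
  define m where "m = min 1 \<epsilon>"
  define M where "M = max 1 (ln (real r / \<epsilon>))"
  have m: "0 < m" "m \<le> 1" using assms by (auto simp: m_def)
  have M: "1 \<le> M" by (simp add: M_def)
  have "m * 1 \<le> 1 * M" using m M by (intro mult_mono) auto
  then have one: "1 \<le> M / m" using m by (simp add: divide_simps)
  have "real (passes (1 + m / 3) (\<epsilon> / 3) r) \<le> 1 + 14 * (M / m)"
  proof (cases "r = 0")
    case True
    then show ?thesis using one by (simp add: passes_def log_def)
  next
    case False
    have "ln (real r / (\<epsilon> / 3)) = ln 3 + ln (real r / \<epsilon>)"
      using False assms by (simp add: ln_mult_pos[symmetric] algebra_simps)
    moreover have "ln 3 \<le> (2 :: real)" using ln_le_minus_one[of 3] by simp
    ultimately have "ln (real r / (\<epsilon> / 3)) \<le> 3 * M" using M by (auto simp: M_def)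
    moreover have "(m / 3) * (2 / 3) \<le> (m / 3) * (1 - m / 3)" using m by (intro mult_left_mono) auto
    then have "2 * m / 9 \<le> m / 3 - (m / 3)\<^sup>2" by (simp add: power2_eq_square algebra_simps)
    then have ln: "2 * m / 9 \<le> ln (1 + m / 3)"
      using ln_one_plus_pos_lower_bound[of "m / 3"] m by linarith
    ultimately have "log (1 + m / 3) (real r / (\<epsilon> / 3)) \<le> 3 * M / ln (1 + m / 3)"
      unfolding log_def using m by (intro divide_right_mono) auto
    also have "\<dots> \<le> 3 * M / (2 * m / 9)" using ln m M by (intro divide_left_mono) auto
    also have "\<dots> \<le> 14 * (M / m)" using m M by (simp add: field_simps)
    finally have "log (1 + m / 3) (real r / (\<epsilon> / 3)) \<le> 14 * (M / m)" .
    then show ?thesis unfolding passes_def using one by linarith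
  qed
  then show ?thesis using one unfolding m_def M_def by simp
qed

lemma some_list_of_finite:
  assumes "finite N"
  shows "set (SOME xs. set xs = N \<and> distinct xs) = N" "distinct (SOME xs. set xs = N \<and> distinct xs)"
  using someI_ex[OF finite_distinct_list[OF assms]] by auto

lemma random_ratio:
  fixes k c d z E :: real
  assumes "1 \<le> k" "1 \<le> c" "0 \<le> d" "c + d \<le> 1 + \<epsilon>" "0 \<le> E"
    and "p = 2 / (1 + sqrt k)" and "(2 - p) * z \<le> 2 * (c * (k + 2 - 1 + 2 * (1 - p) / p) + k * d) * E"
  shows "z \<le> (1 + \<epsilon>) * (1 + sqrt k)\<^sup>2 * E"
proof -
  define s where "s = sqrt k"
  have s: "1 \<le> s" "k = s * s" using assms(1) by (auto simp: s_def)
  have p: "2 - p = 2 * s / (1 + s)" "2 * (1 - p) / p = s - 1"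
    using s by (auto simp: assms(6) s_def[symmetric] field_simps)
  have "2 * s / (1 + s) * z \<le> 2 * (c * (s * s + s) + s * s * d) * E"
    using assms(7) unfolding p s(2) by (simp add: algebra_simps)
  then have "(1 + s) / (2 * s) * (2 * s / (1 + s) * z) \<le>
      (1 + s) / (2 * s) * (2 * (c * (s * s + s) + s * s * d) * E)"
    using s by (intro mult_left_mono) auto
  moreover have "(1 + s) / (2 * s) * (2 * s / (1 + s) * z) = z"
  proof -
    have "s \<noteq> 0" "1 + s \<noteq> 0" using s by auto
    then show ?thesis by simp
  qed
  moreover have "(1 + s) / (2 * s) * (2 * (c * (s * s + s) + s * s * d) * E) =
      ((1 + s) * (1 + s) * c + (1 + s) * s * d) * E"
    using s by (simp add: field_simps)
  ultimately have "z \<le> ((1 + s) * (1 + s) * c + (1 + s) * s * d) * E" by simp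
  also have "\<dots> \<le> ((1 + s) * (1 + s) * c + (1 + s) * (1 + s) * d) * E"
    using assms s by (intro mult_right_mono add_left_mono mult_mono) auto
  also have "\<dots> = (c + d) * (1 + s)\<^sup>2 * E" by (simp add: power2_eq_square algebra_simps)
  also have "\<dots> \<le> (1 + \<epsilon>) * (1 + s)\<^sup>2 * E" using assms by (intro mult_right_mono) auto
  finally show ?thesis by (simp add: s_def)
qed

lemma deterministic_ratio:
  fixes k c d z E :: real and l :: nat
  assumes "1 \<le> k" "1 \<le> c" "0 \<le> d" "c + d \<le> 1 + \<epsilon>" "0 \<le> E"
    and "real l = of_int \<lceil>sqrt k\<rceil> + 1"
    and "(real l - 1) * z \<le> real l * (c * (k + real l - 1) + k * d) * E"
  shows "z \<le> (1 + \<epsilon>) * (k + sqrt k + of_int \<lceil>sqrt k\<rceil> + 1) * E"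
proof -
  define s where "s = sqrt k"
  define q :: real where "q = of_int \<lceil>sqrt k\<rceil>"
  have s: "1 \<le> s" "k = s * s" using assms(1) by (auto simp: s_def)
  have q: "s \<le> q" by (simp add: s_def q_def)
  define R where "R = k + s + q + 1"
  have "s * s \<le> s * q" using s q by (intro mult_left_mono) auto
  then have 1: "(q + 1) * (k + q) \<le> q * R" using s q by (simp add: R_def algebra_simps)
  have "(q + 1) * k \<le> (q + 1) * (k + q)" using s q by (intro mult_left_mono) auto
  with 1 have 2: "(q + 1) * k \<le> q * R" by linarith
  have "q * z \<le> (q + 1) * (c * (k + q) + k * d) * E" using assms(6,7) by (simp add: q_def)
  also have "\<dots> = (c * ((q + 1) * (k + q)) + d * ((q + 1) * k)) * E" by (simp add: algebra_simps)
  also have "\<dots> \<le> (c * (q * R) + d * (q * R)) * E"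
    using assms 1 2 by (intro mult_right_mono add_mono mult_left_mono) auto
  also have "\<dots> = q * ((c + d) * R * E)" by (simp add: algebra_simps)
  finally have "z \<le> (c + d) * R * E" using s q by (simp add: mult_le_cancel_left_pos)
  also have "\<dots> \<le> (1 + \<epsilon>) * R * E" using assms s q by (intro mult_right_mono) (auto simp: R_def)
  finally show ?thesis by (simp add: R_def s_def q_def)
qed

theorem theorem2:
  "\<exists>C>0. \<forall>\<epsilon>>0. \<forall>k\<ge>1.
     (\<exists>A :: 'a set \<Rightarrow> ('a, 'a set) oracle_alg.
        \<forall>N f I. finite N \<and> (\<forall>S\<subseteq>N. f S \<ge> 0) \<and> submodular_on N f \<and> k_system k N I \<longrightarrow>
          opt f I \<le> (1 + \<epsilon>) * (1 + sqrt k)\<^sup>2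
                      * measure_pmf.expectation (run f I (A N)) (\<lambda>(S, q). f S) \<and>
          (\<forall>(S, q) \<in> set_pmf (run f I (A N)).
             S \<in> I \<and>
             real q \<le> C * (real (card N) / min 1 \<epsilon>) * max 1 (ln (real (sys_rank I) / \<epsilon>)))) \<and>
     (\<exists>A :: 'a set \<Rightarrow> ('a, 'a set) oracle_alg.
        (\<forall>N. deterministic (A N)) \<and>
        (\<forall>N f I. finite N \<and> (\<forall>S\<subseteq>N. f S \<ge> 0) \<and> submodular_on N f \<and> k_system k N I \<longrightarrow>
          (\<forall>(S, q) \<in> set_pmf (run f I (A N)).
             S \<in> I \<and>
             opt f I \<le> (1 + \<epsilon>) * (k + sqrt k + of_int \<lceil>sqrt k\<rceil> + 1) * f S \<and>
             real q \<le> C * (sqrt k * real (card N) / min 1 \<epsilon>)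
                         * max 1 (ln (sqrt k * real (sys_rank I) / \<epsilon>)))))"
proof (intro exI[of _ "576 :: real"] conjI allI impI)
  fix \<epsilon> k :: real assume \<epsilon>: "0 < \<epsilon>" and k: "1 \<le> k"
  define c where "c = 1 + min 1 \<epsilon> / 3"
  define d where "d = \<epsilon> / 3"
  define xs :: "'a set \<Rightarrow> 'a list" where "xs = (\<lambda>N. SOME xs. set xs = N \<and> distinct xs)"
  have c: "1 < c" and d: "0 < d" and cd: "c + d \<le> 1 + \<epsilon>" using \<epsilon> by (auto simp: c_def d_def)
  have xs: "set (xs N) = N" "distinct (xs N)" if "finite N" for N
    using some_list_of_finite[OF that] by (auto simp: xs_def)
  have queries: "real q \<le> 192 * (real l * real n / min 1 \<epsilon>) * max 1 (ln (real r / \<epsilon>))"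
    if "q \<le> 12 * (l * n * Suc (passes c d r))" for q l n r
  proof -
    have "real q \<le> real (12 * (l * n * Suc (passes c d r)))" using that by (rule of_nat_mono)
    also have "\<dots> = 12 * real l * real n * real (Suc (passes c d r))" by (simp add: algebra_simps)
    also have "\<dots> \<le> 12 * real l * real n * (16 / min 1 \<epsilon> * max 1 (ln (real r / \<epsilon>)))"
      unfolding c_def d_def by (intro mult_left_mono passes_bound[OF \<epsilon>]) auto
    finally show ?thesis by simp
  qed
  show "\<exists>A :: 'a set \<Rightarrow> ('a, 'a set) oracle_alg.
        \<forall>N f I. finite N \<and> (\<forall>S\<subseteq>N. f S \<ge> 0) \<and> submodular_on N f \<and> k_system k N I \<longrightarrow>
          opt f I \<le> (1 + \<epsilon>) * (1 + sqrt k)\<^sup>2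
                      * measure_pmf.expectation (run f I (A N)) (\<lambda>(S, q). f S) \<and>
          (\<forall>(S, q) \<in> set_pmf (run f I (A N)).
             S \<in> I \<and>
             real q \<le> 576 * (real (card N) / min 1 \<epsilon>) * max 1 (ln (real (sys_rank I) / \<epsilon>)))"
  proof -
    define p where "p = 2 / (1 + sqrt k)"
    have "0 < 1 + sqrt k" "2 \<le> 1 + sqrt k" using k by (auto intro: add_pos_nonneg)
    then have p: "0 < p" "p \<le> 1" unfolding p_def
      by (simp_all only: zero_less_divide_iff divide_le_eq_1_pos) simp
    show ?thesis
    proof (intro exI[of _ "\<lambda>N. multi_greedy p 2 c d (xs N)"] allI impI)
      fix N :: "'a set" and f I
      assume *: "finite N \<and> (\<forall>S\<subseteq>N. f S \<ge> 0) \<and> submodular_on N f \<and> k_system k N I"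
      interpret k_system_maximization N f I k by unfold_locales (use * in auto)
      let ?A = "multi_greedy p 2 c d (xs N)"
      obtain Z where Z: "Z \<in> I" "opt f I = f Z" by (rule opt_attained)
      have sat: "sat f I ?A (\<lambda>S q. S \<in> I \<and> q \<le> 12 * (2 * card N * Suc (passes c d (sys_rank I))))"
        using xs[OF finite_N] c d by (intro sat_multi_greedy) auto
      have "ev f I (\<lambda>_. 0) ?A \<le> ev f I f ?A"
        by (rule ev_mono, rule sat_mono[OF sat]) (use nonneg indep_subset_N in blast)
      then have "0 \<le> ev f I f ?A" by (simp add: ev_const)
      then have "f Z \<le> (1 + \<epsilon>) * (1 + sqrt k)\<^sup>2 * ev f I f ?A"
        using ev_multi_greedy[OF xs(1)[OF finite_N] order_refl c d p Z(1)] c d k cd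
        by (intro random_ratio[where p = p and c = c and d = d]) (auto simp: p_def)
      moreover have "real q \<le> 576 * (real (card N) / min 1 \<epsilon>) * max 1 (ln (real (sys_rank I) / \<epsilon>))"
        if "q \<le> 12 * (2 * card N * Suc (passes c d (sys_rank I)))" for q
      proof -
        let ?X = "(real (card N) / min 1 \<epsilon>) * max 1 (ln (real (sys_rank I) / \<epsilon>))"
        have "0 \<le> ?X" using \<epsilon> by (intro mult_nonneg_nonneg) auto
        then show ?thesis using queries[OF that] by simp
      qed
      ultimately show "opt f I \<le> (1 + \<epsilon>) * (1 + sqrt k)\<^sup>2
            * measure_pmf.expectation (run f I ?A) (\<lambda>(S, q). f S) \<and>
          (\<forall>(S, q) \<in> set_pmf (run f I ?A). S \<in> I \<and>
             real q \<le> 576 * (real (card N) / min 1 \<epsilon>) * max 1 (ln (real (sys_rank I) / \<epsilon>)))"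
        using sat_set_pmf[OF sat] unfolding expectation_run Z(2) by blast
    qed
  qed
  show "\<exists>A :: 'a set \<Rightarrow> ('a, 'a set) oracle_alg.
        (\<forall>N. deterministic (A N)) \<and>
        (\<forall>N f I. finite N \<and> (\<forall>S\<subseteq>N. f S \<ge> 0) \<and> submodular_on N f \<and> k_system k N I \<longrightarrow>
          (\<forall>(S, q) \<in> set_pmf (run f I (A N)).
             S \<in> I \<and>
             opt f I \<le> (1 + \<epsilon>) * (k + sqrt k + of_int \<lceil>sqrt k\<rceil> + 1) * f S \<and>
             real q \<le> 576 * (sqrt k * real (card N) / min 1 \<epsilon>)
                         * max 1 (ln (sqrt k * real (sys_rank I) / \<epsilon>))))"
  proof -
    define l where "l = nat \<lceil>sqrt k\<rceil> + 1"
    have "1 \<le> sqrt k" using k by simp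
    then have "1 \<le> \<lceil>sqrt k\<rceil>" by linarith
    then have l: "2 \<le> l" "real l = of_int \<lceil>sqrt k\<rceil> + 1" unfolding l_def by linarith+
    have "of_int \<lceil>sqrt k\<rceil> \<le> sqrt k + 1" by linarith
    then have l3: "real l \<le> 3 * sqrt k" unfolding l(2) using \<open>1 \<le> sqrt k\<close> by linarith
    show ?thesis
    proof (intro exI[of _ "\<lambda>N. multi_greedy 1 l c d (xs N)"] conjI allI impI)
      fix N :: "'a set" and f I
      assume *: "finite N \<and> (\<forall>S\<subseteq>N. f S \<ge> 0) \<and> submodular_on N f \<and> k_system k N I"
      interpret k_system_maximization N f I k by unfold_locales (use * in auto)
      let ?A = "multi_greedy 1 l c d (xs N)"
      obtain Z where Z: "Z \<in> I" "opt f I = f Z" by (rule opt_attained)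
      have sat: "sat f I ?A (\<lambda>S q. S \<in> I \<and> q \<le> 12 * (l * card N * Suc (passes c d (sys_rank I))))"
        using xs[OF finite_N] c d l by (intro sat_multi_greedy) auto
      obtain S q where run: "run f I ?A = return_pmf (S, q)"
        using deterministic_run[OF deterministic_multi_greedy] by blast
      have Sq: "S \<in> I \<and> q \<le> 12 * (l * card N * Suc (passes c d (sys_rank I)))"
        by (rule sat_set_pmf[OF sat]) (simp add: run)
      have "ev f I f ?A = f S" unfolding expectation_run[symmetric] run by simp
      then have "(real l - 1) * f Z \<le> real l * (c * (k + real l - 1) + k * d) * f S"
        using ev_multi_greedy[OF xs(1)[OF finite_N] l(1) c d zero_less_one order_refl Z(1)] by simp
      then have "f Z \<le> (1 + \<epsilon>) * (k + sqrt k + of_int \<lceil>sqrt k\<rceil> + 1) * f S"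
        using c d k cd l nonneg[OF indep_subset_N] Sq
        by (intro deterministic_ratio[where c = c and d = d and l = l]) auto
      moreover have "real q \<le> 576 * (sqrt k * real (card N) / min 1 \<epsilon>)
                         * max 1 (ln (sqrt k * real (sys_rank I) / \<epsilon>))"
      proof -
        have "ln (real (sys_rank I) / \<epsilon>) \<le> ln (sqrt k * real (sys_rank I) / \<epsilon>)"
        proof (cases "sys_rank I = 0")
          case False
          have "1 * real (sys_rank I) \<le> sqrt k * real (sys_rank I)"
            using \<open>1 \<le> sqrt k\<close> by (intro mult_right_mono) auto
          then have "real (sys_rank I) / \<epsilon> \<le> sqrt k * real (sys_rank I) / \<epsilon>"
            using \<epsilon> by (intro divide_right_mono) auto
          then show ?thesis using False \<epsilon> by (intro ln_mono) auto
        qed simp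
        moreover have "real l * real (card N) / min 1 \<epsilon> \<le> 3 * sqrt k * real (card N) / min 1 \<epsilon>"
          using l3 \<epsilon> by (intro divide_right_mono mult_right_mono) auto
        ultimately have "192 * (real l * real (card N) / min 1 \<epsilon>) * max 1 (ln (real (sys_rank I) / \<epsilon>))
          \<le> 192 * (3 * sqrt k * real (card N) / min 1 \<epsilon>)
              * max 1 (ln (sqrt k * real (sys_rank I) / \<epsilon>))"
          using k \<epsilon> by (intro mult_mono max.mono mult_nonneg_nonneg divide_nonneg_nonneg) auto
        then show ?thesis using queries[OF conjunct2[OF Sq]] by simp
      qed
      ultimately show "\<forall>(S, q) \<in> set_pmf (run f I ?A). S \<in> I \<and>
             opt f I \<le> (1 + \<epsilon>) * (k + sqrt k + of_int \<lceil>sqrt k\<rceil> + 1) * f S \<and>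
             real q \<le> 576 * (sqrt k * real (card N) / min 1 \<epsilon>)
                         * max 1 (ln (sqrt k * real (sys_rank I) / \<epsilon>))"
        using Sq by (simp add: run Z(2))
    qed (rule deterministic_multi_greedy)
  qed
qed simp

end
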